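(* Let $\mathcal{A}$ be a finite alphabet, $\mathcal{F}$ the free group over $\mathcal{A}$, and $k\ge 2$. Let $S\subseteq\mathcal{F}$ be strongly $k$-product-free. Then $\bar{d}(S)\le \frac{1}{k}$.
   Context: A subset $S$ of a semigroup is $\ell$-product-free ($\ell\ge2$) if there are no $x_1,\dots,x_\ell,y\in S$ (not necessarily distinct) with $x_1\cdots x_\ell=y$; it is strongly $k$-product-free if it is $\ell$-product-free for every $\ell$ with $2\le \ell\le k$. Every element $w\in\mathcal{F}$ is identified with its reduced word, and $|w|$ denotes the length of the reduced word. For $A\subseteq \mathcal{F}$ and $n\ge 1$, $A(n)=\{w\in A: |w|=n\}$ and $A_{\le n}=\{w\in A: |w|\le n\}$. The measure $\mu$ on $\mathcal{F}$ is defined by $\mu(\{w\}) = 1/|\mathcal{F}(|w|)| = \frac{1}{2|\mathcal{A}|(2|\mathcal{A}|-1)^{|w|-1}}$. The upper asymptotic density is $\bar{d}(A)=\limsup_{n\to\infty}\frac{\mu(A_{\le n})}{\mu(\mathcal{F}_{\le n})}$. *)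

theory Defs
  imports Complex_Main "HOL-Library.Extended_Real" "HOL-Library.Liminf_Limsup"
begin

text \<open>Free group over the finite alphabet UNIV :: 'a set. A letter is a pair (a, b);
  (a, False) stands for the generator a, (a, True) for its inverse.
  Elements of the free group are identified with reduced words.\<close>

type_synonym 'a fg_word = "('a \<times> bool) list"

definition inv_letter :: "'a \<times> bool \<Rightarrow> 'a \<times> bool" where
  "inv_letter x = (fst x, \<not> snd x)"

definition reduced :: "'a fg_word \<Rightarrow> bool" where
  "reduced w \<longleftrightarrow> (\<forall>i. Suc i < length w \<longrightarrow> w ! Suc i \<noteq> inv_letter (w ! i))"

fun reduce :: "'a fg_word \<Rightarrow> 'a fg_word" where
  "reduce [] = []"
| "reduce (x # xs) = (case reduce xs of
      [] \<Rightarrow> [x]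
    | y # ys \<Rightarrow> (if y = inv_letter x then ys else x # y # ys))"

definition fg_mult :: "'a fg_word \<Rightarrow> 'a fg_word \<Rightarrow> 'a fg_word" where
  "fg_mult u v = reduce (u @ v)"

definition free_group :: "'a fg_word set" where
  "free_group = {w. reduced w}"

definition fg_prod :: "'a fg_word list \<Rightarrow> 'a fg_word" where
  "fg_prod xs = foldr fg_mult xs []"

definition l_product_free :: "nat \<Rightarrow> 'a fg_word set \<Rightarrow> bool" where
  "l_product_free l S \<longleftrightarrow>
     \<not> (\<exists>xs y. length xs = l \<and> set xs \<subseteq> S \<and> y \<in> S \<and> fg_prod xs = y)"

definition strongly_product_free :: "nat \<Rightarrow> 'a fg_word set \<Rightarrow> bool" where
  "strongly_product_free k S \<longleftrightarrow> (\<forall>l. 2 \<le> l \<and> l \<le> k \<longrightarrow> l_product_free l S)"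

definition level :: "'a fg_word set \<Rightarrow> nat \<Rightarrow> 'a fg_word set" where
  "level A n = {w \<in> A. length w = n}"

definition upto_level :: "'a fg_word set \<Rightarrow> nat \<Rightarrow> 'a fg_word set" where
  "upto_level A n = {w \<in> A. length w \<le> n}"

definition fg_mu :: "'a::finite fg_word set \<Rightarrow> real" where
  "fg_mu A = (\<Sum>w\<in>A. 1 / real (card (level (free_group :: 'a fg_word set) (length w))))"

definition upper_density :: "'a::finite fg_word set \<Rightarrow> ereal" where
  "upper_density A =
     limsup (\<lambda>n. ereal (fg_mu (upto_level A n) / fg_mu (upto_level (free_group :: 'a fg_word set) n)))"

end

theory Submission
  imports "HOL-Complex_Analysis.Great_Picard" Defs (* in this order: reduced also names a constant of Brouwer_Fixpoint *)
begin

text \<open>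
  Let \<open>g u\<close> be a subsequential limit of the density of \<open>S\<close> among the reduced words with suffix \<open>u\<close>.
  It is harmonic for extending \<open>u\<close> to the left, so it is a bounded martingale on growing suffixes.
  Suppose that some \<open>g u\<close> exceeds \<open>1/k\<close>, and take a long \<open>u\<close> with \<open>g u\<close> close to the supremum of \<open>g\<close>.
  Given \<open>h\<close> with suffix \<open>u\<close>, all but a fraction at most \<open>1/k\<close> of the long words \<open>s = y u\<close> have \<open>g s\<close>
  close to the supremum and do not begin with the inverse of \<open>h\<close>, so \<open>h\<close> is not fully cancelled in \<open>h s\<close>; by L2-convergence
  \<open>g (h s)\<close> is also large. As \<open>S\<close> has density \<open>g u > 1/k\<close> among these words, such an \<open>s\<close> exists in \<open>S\<close>.
  Iterating yields \<open>h\<^sub>0, \<dots>, h\<^bsub>k-1\<^esub>\<close> with \<open>h\<^bsub>i+1\<^esub> = h\<^sub>i s\<^sub>i\<close>, \<open>s\<^sub>i \<in> S\<close>, the same first letter and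
  \<open>g (h\<^sub>i) > 1/k\<close>. The sets \<open>{z. z h\<^sub>i \<in> S}\<close> are pairwise disjoint since
  \<open>z h\<^sub>j = (z h\<^sub>i) s\<^sub>i \<cdots> s\<^bsub>j-1\<^esub>\<close> is a product of at most \<open>k\<close> factors, so the \<open>g (h\<^sub>i)\<close> sum to at most 1,
  a contradiction.
\<close>

subsection \<open>Reduced words and products in the free group\<close>

lemma inv_letter_inv [simp]: "inv_letter (inv_letter x) = x"
  by (simp add: inv_letter_def)

lemma reduced_iff_successively: "reduced w \<longleftrightarrow> successively (\<lambda>x y. y \<noteq> inv_letter x) w"
  by (simp add: reduced_def successively_conv_nth)

lemma reduced_Nil [simp]: "reduced []"
  and reduced_singleton [simp]: "reduced [a]"
  by (simp_all add: reduced_def)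

lemma reduced_Cons: "reduced (a # w) \<longleftrightarrow> w = [] \<or> hd w \<noteq> inv_letter a \<and> reduced w"
  by (simp add: reduced_iff_successively successively_Cons)

lemma reduced_append:
  "reduced (v @ w) \<longleftrightarrow>
     reduced v \<and> reduced w \<and> (v = [] \<or> w = [] \<or> hd w \<noteq> inv_letter (last v))"
  by (simp add: reduced_iff_successively successively_append_iff)

lemma reduced_reduce: "reduced (reduce w)"
  by (induction w) (auto simp: reduced_Cons split: list.splits)

lemma reduce_reduced: "reduced w \<Longrightarrow> reduce w = w"
  by (induction w) (auto simp: reduced_Cons split: list.splits)

lemma reduce_append_reduce: "reduce (u @ reduce v) = reduce (u @ v)"
  by (induction u) (simp_all add: reduce_reduced[OF reduced_reduce])

lemma reduce_inv_pair: "reduce (x # inv_letter x # w) = reduce w"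
  using reduced_reduce[of w] by (auto simp: reduced_Cons split: list.splits)

lemma reduce_reduce_append: "reduce (reduce u @ v) = reduce (u @ v)"
proof (induction u)
  case (Cons x u)
  show ?case
  proof (cases "reduce u")
    case Nil
    then show ?thesis using Cons by simp
  next
    case (Cons y ys)
    have *: "reduce (x # reduce u @ v) = reduce ((x # u) @ v)"
      using Cons.IH by simp
    show ?thesis
    proof (cases "y = inv_letter x")
      case True
      then have "reduce (x # reduce u @ v) = reduce (ys @ v)"
        using Cons reduce_inv_pair by (metis append_Cons)
      then show ?thesis using * True Cons by simp
    next
      case False
      then show ?thesis using * Cons by simp
    qed
  qed
qed simp

lemma fg_prod_eq_reduce_concat: "fg_prod ws = reduce (concat ws)"
  by (induction ws) (simp_all add: fg_prod_def fg_mult_def reduce_append_reduce)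

definition inv_word :: "'a fg_word \<Rightarrow> 'a fg_word" where
  "inv_word w = map inv_letter (rev w)"

lemma length_inv_word [simp]: "length (inv_word w) = length w"
  by (simp add: inv_word_def)

lemma reduce_cancel: "reduce (u @ e @ inv_word e @ v) = reduce (u @ v)"
proof (induction e arbitrary: v rule: rev_induct)
  case (snoc a e)
  have "reduce (u @ (e @ [a]) @ inv_word (e @ [a]) @ v)
      = reduce ((u @ e) @ reduce (a # inv_letter a # inv_word e @ v))"
    by (simp only: reduce_append_reduce) (simp add: inv_word_def del: reduce.simps)
  also have "\<dots> = reduce ((u @ e) @ inv_word e @ v)"
    by (simp only: reduce_inv_pair reduce_append_reduce)
  finally show ?case using snoc by simp
qed (simp add: inv_word_def)

text \<open>The last letter of \<open>h\<close> is stripped against the first letter of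
  \<open>v\<close> for as long as the two cancel, and \<open>e\<close> collects what was stripped.
  The hypothesis on \<open>take\<close> stops this before \<open>h\<close> is used up.\<close>

lemma cancellation_split:
  assumes "reduced h" "reduced v" "length h \<le> length v" "h \<noteq> []"
    and "take (length h) v \<noteq> inv_word h"
  obtains h' e v' where "h = h' @ e" "v = inv_word e @ v'" "h' \<noteq> []" "reduced (h' @ v')"
proof -
  have "\<exists>h' e v'. h = h' @ e \<and> v = inv_word e @ v' \<and> h' \<noteq> [] \<and> reduced (h' @ v')"
    using assms
  proof (induction h arbitrary: v rule: rev_induct)
    case (snoc a h)
    then obtain b v1 where v: "v = b # v1"
      by (cases v) auto
    show ?case
    proof (cases "b = inv_letter a")
      case False
      then have "reduced ((h @ [a]) @ v)"
        using snoc.prems v unfolding reduced_append[of "h @ [a]" v] by simp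
      then show ?thesis
        by (intro exI[of _ "h @ [a]"] exI[of _ "[]"] exI[of _ v]) (simp add: inv_word_def)
    next
      case True
      have "h \<noteq> []"
        using snoc.prems(5) True v by (auto simp: inv_word_def)
      moreover have "reduced v1" using snoc.prems(2) v by (auto simp: reduced_Cons)
      ultimately obtain h' e v' where
        "h = h' @ e" "v1 = inv_word e @ v'" "h' \<noteq> []" "reduced (h' @ v')"
        using snoc.IH[of v1] snoc.prems v True by (auto simp: reduced_append inv_word_def)
      then show ?thesis using True v
        by (intro exI[of _ h'] exI[of _ "e @ [a]"] exI[of _ v']) (simp add: inv_word_def)
    qed
  qed simp
  then show thesis using that by blast
qed

subsection \<open>Averages over left extensions\<close>

text \<open>The set holds the added prefixes, not the extended words: for nonempty reduced
  \<open>u\<close> it depends only on the first letter of \<open>u\<close>, so words with the same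
  first letter share it.\<close>

definition left_ext :: "nat \<Rightarrow> 'a fg_word \<Rightarrow> 'a fg_word set" where
  "left_ext l u = {x. length x = l \<and> reduced (x @ u)}"

definition ext_avg :: "nat \<Rightarrow> 'a::finite fg_word \<Rightarrow> ('a fg_word \<Rightarrow> real) \<Rightarrow> real" where
  "ext_avg l u f = (\<Sum>x\<in>left_ext l u. f x) / real (card (left_ext l u))"

abbreviation branching :: "'a::finite itself \<Rightarrow> nat" where
  "branching _ \<equiv> 2 * CARD('a) - 1"

lemma branching_pos: "branching TYPE('a::finite) \<ge> 1"
  using zero_less_card_finite[where 'a='a] by linarith

lemma finite_left_ext [simp]: "finite (left_ext l (u :: 'a::finite fg_word))"
  by (rule finite_subset[OF _ finite_lists_length_eq[of UNIV l]]) (auto simp: left_ext_def)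

lemma left_ext_0: "reduced u \<Longrightarrow> left_ext 0 u = {[]}"
  by (auto simp: left_ext_def)

lemma sum_left_ext_add:
  fixes f :: "'a::finite fg_word \<Rightarrow> 'b::comm_monoid_add"
  shows "(\<Sum>x\<in>left_ext (i + j) u. f x)
       = (\<Sum>y\<in>left_ext j u. \<Sum>x\<in>left_ext i (y @ u). f (x @ y))"
proof -
  have *: "reduced (drop i b @ u) \<and> reduced (take i b @ drop i b @ u)" if "reduced (b @ u)" for b
    using that reduced_append[of "take i b" "drop i b @ u"]
    by (metis append_assoc append_take_drop_id)
  have "(\<Sum>y\<in>left_ext j u. \<Sum>x\<in>left_ext i (y @ u). f (x @ y))
      = (\<Sum>(y, x)\<in>Sigma (left_ext j u) (\<lambda>y. left_ext i (y @ u)). f (x @ y))"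
    by (rule sum.Sigma) auto
  also have "\<dots> = (\<Sum>x\<in>left_ext (i + j) u. f x)"
    by (rule sum.reindex_bij_witness[of _ "\<lambda>x. (drop i x, take i x)" "\<lambda>(y, x). x @ y"])
      (use * in \<open>auto simp: left_ext_def\<close>)
  finally show ?thesis ..
qed

lemma card_left_ext_1:
  assumes "reduced u" "u \<noteq> []"
  shows "card (left_ext 1 (u :: 'a::finite fg_word)) = branching TYPE('a)"
proof -
  have "left_ext 1 u = (\<lambda>a. [a]) ` (UNIV - {inv_letter (hd u)})"
    using assms by (force simp: left_ext_def length_Suc_conv reduced_append)
  then have "card (left_ext 1 u) = card (UNIV - {inv_letter (hd u)})"
    by (simp add: card_image inj_on_def)
  also have "\<dots> = branching TYPE('a)"
    by (simp add: card_Diff_singleton)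
  finally show ?thesis .
qed

lemma card_left_ext:
  assumes "reduced u" "u \<noteq> []"
  shows "card (left_ext l (u :: 'a::finite fg_word)) = branching TYPE('a) ^ l"
proof (induction l)
  case 0
  then show ?case using assms by (simp add: left_ext_0)
next
  case (Suc l)
  have "card (left_ext (1 + l) u) = (\<Sum>y\<in>left_ext l u. \<Sum>x\<in>left_ext 1 (y @ u). 1)"
    using sum_left_ext_add[of "\<lambda>_. 1::nat" 1 l u] by simp
  also have "\<dots> = (\<Sum>y\<in>left_ext l u. branching TYPE('a))"
    using assms by (intro sum.cong refl) (simp only: card_eq_sum[symmetric], subst card_left_ext_1,
        auto simp: left_ext_def)
  finally show ?case using Suc by simp
qed

lemma card_left_ext_pos:
  assumes "reduced u" "u \<noteq> []"
  shows "0 < real (card (left_ext l (u :: 'a::finite fg_word)))"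
  using card_left_ext[OF assms, of l] branching_pos[where 'a='a] by simp

text \<open>Tower property: the block \<open>y\<close> next to \<open>u\<close> is averaged last.
  Uniform averages compose because all nonempty reduced words have equally many extensions of a
  given length; the empty word has one more letter to choose from.\<close>

lemma ext_avg_add:
  assumes "reduced u" "u \<noteq> []"
  shows "ext_avg (i + j) u f = ext_avg j u (\<lambda>y. ext_avg i (y @ u) (\<lambda>x. f (x @ y)))"
proof -
  have "ext_avg i (y @ u) F = (\<Sum>x\<in>left_ext i (y @ u). F x) / real (branching TYPE('a) ^ i)"
    if "y \<in> left_ext j u" for y F
    using that assms card_left_ext[of "y @ u" i] by (simp add: ext_avg_def left_ext_def)
  then have "ext_avg j u (\<lambda>y. ext_avg i (y @ u) (\<lambda>x. f (x @ y)))
      = (\<Sum>y\<in>left_ext j u. (\<Sum>x\<in>left_ext i (y @ u). f (x @ y)) / real (branching TYPE('a) ^ i))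
        / real (branching TYPE('a) ^ j)"
    using assms by (simp add: ext_avg_def[of j] card_left_ext cong: sum.cong)
  also have "\<dots> = ext_avg (i + j) u f"
    using assms unfolding ext_avg_def sum_left_ext_add
    by (simp add: card_left_ext power_add sum_divide_distrib[symmetric])
  finally show ?thesis ..
qed

lemma ext_avg_cong:
  "(\<And>x. x \<in> left_ext l u \<Longrightarrow> f x = g x) \<Longrightarrow> ext_avg l u f = ext_avg l u g"
  by (simp add: ext_avg_def cong: sum.cong)

lemma ext_avg_mono:
  "(\<And>x. x \<in> left_ext l u \<Longrightarrow> f x \<le> g x) \<Longrightarrow> ext_avg l u f \<le> ext_avg l u g"
  by (simp add: ext_avg_def divide_right_mono sum_mono)

lemma ext_avg_plus: "ext_avg l u (\<lambda>x. f x + g x) = ext_avg l u f + ext_avg l u g"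
  by (simp add: ext_avg_def sum.distrib add_divide_distrib)

lemma ext_avg_diff: "ext_avg l u (\<lambda>x. f x - g x) = ext_avg l u f - ext_avg l u g"
  by (simp add: ext_avg_def sum_subtractf diff_divide_distrib)

lemma ext_avg_cmult: "ext_avg l u (\<lambda>x. c * f x) = c * ext_avg l u f"
  by (simp add: ext_avg_def sum_distrib_left)

lemma ext_avg_divide: "ext_avg l u (\<lambda>x. f x / c) = ext_avg l u f / c"
  by (simp add: ext_avg_def sum_divide_distrib[symmetric] mult.commute)

lemma ext_avg_sum: "ext_avg l u (\<lambda>x. \<Sum>i\<in>I. f i x) = (\<Sum>i\<in>I. ext_avg l u (f i))"
  by (simp add: ext_avg_def sum.swap[of _ I] sum_divide_distrib[symmetric])

lemma ext_avg_const: "\<lbrakk>reduced u; u \<noteq> []\<rbrakk> \<Longrightarrow> ext_avg l u (\<lambda>x. c) = c"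
  using card_left_ext_pos[of u l] unfolding ext_avg_def by (auto simp del: card_gt_0_iff)

lemma ext_avg_nonneg: "(\<And>x. x \<in> left_ext l u \<Longrightarrow> 0 \<le> f x) \<Longrightarrow> 0 \<le> ext_avg l u f"
  by (simp add: ext_avg_def sum_nonneg)

lemma ext_avg_drop:
  assumes "reduced u" "u \<noteq> []" "i \<le> m"
  shows "ext_avg m u (\<lambda>y. f (drop i y)) = ext_avg (m - i) u f"
proof -
  have "ext_avg (i + (m - i)) u (\<lambda>y. f (drop i y))
      = ext_avg (m - i) u (\<lambda>y. ext_avg i (y @ u) (\<lambda>x. f y))"
    unfolding ext_avg_add[OF assms(1,2)]
    by (intro ext_avg_cong) (auto simp: left_ext_def)
  also have "\<dots> = ext_avg (m - i) u f"
    using assms by (intro ext_avg_cong ext_avg_const) (auto simp: left_ext_def)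
  finally show ?thesis using assms by simp
qed

text \<open>Once the \<open>m - i\<close> letters next to \<open>u\<close> are fixed, the first
  \<open>i\<close> letters range uniformly over a set of \<open>branching ^ i\<close> words, and at
  most one of these is \<open>t\<close>.\<close>

lemma ext_avg_take:
  fixes u :: "'a::finite fg_word"
  assumes "reduced u" "u \<noteq> []" "i \<le> m"
  shows "ext_avg m u (\<lambda>y. of_bool (take i y = t)) \<le> 1 / real (branching TYPE('a)) ^ i"
proof -
  have "ext_avg (i + (m - i)) u (\<lambda>y. of_bool (take i y = t))
      = ext_avg (m - i) u (\<lambda>y. ext_avg i (y @ u) (\<lambda>x. of_bool (x = t)))"
    unfolding ext_avg_add[OF assms(1,2)]
    by (intro ext_avg_cong) (auto simp: left_ext_def)
  also have "\<dots> \<le> ext_avg (m - i) u (\<lambda>y. 1 / real (branching TYPE('a)) ^ i)"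
  proof (rule ext_avg_mono)
    fix y assume "y \<in> left_ext (m - i) u"
    then have "reduced (y @ u)" "y @ u \<noteq> []" using assms by (auto simp: left_ext_def)
    moreover have "(\<Sum>x\<in>left_ext i (y @ u). of_bool (x = t)) \<le> (1::real)"
    proof -
      have "(\<Sum>x\<in>left_ext i (y @ u). of_bool (x = t)) =
          (\<Sum>x\<in>left_ext i (y @ u). if x = t then 1 else (0::real))"
        by (intro sum.cong) auto
      then show ?thesis by (simp add: sum.delta')
    qed
    ultimately show "ext_avg i (y @ u) (\<lambda>x. of_bool (x = t)) \<le> 1 / real (branching TYPE('a)) ^ i"
      unfolding ext_avg_def
      by (subst card_left_ext) (auto simp del: sum_of_bool_eq of_nat_diff intro!: divide_right_mono)
  qed
  also have "\<dots> = 1 / real (branching TYPE('a)) ^ i"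
    using assms by (simp add: ext_avg_const)
  finally show ?thesis using assms by simp
qed

subsection \<open>Limit densities over left extensions\<close>

text \<open>Words of length at most \<^term>\<open>n\<close> are replaced by extensions by fewer than \<^term>\<open>n\<close> letters; this
  does not affect limits and lets \<open>sum_g_le_1\<close> compare suffixes of different lengths.\<close>

definition ext_density :: "'a::finite fg_word set \<Rightarrow> nat \<Rightarrow> 'a fg_word \<Rightarrow> real" where
  "ext_density S m u = ext_avg m u (\<lambda>y. of_bool (y @ u \<in> S))"

definition mean_density :: "'a::finite fg_word set \<Rightarrow> nat \<Rightarrow> 'a fg_word \<Rightarrow> real" where
  "mean_density S n u = (\<Sum>m<n. ext_density S m u) / real n"

lemma ext_density_nonneg: "0 \<le> ext_density S m u"
  by (simp add: ext_density_def ext_avg_nonneg)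

lemma ext_density_le_1: "\<lbrakk>reduced u; u \<noteq> []\<rbrakk> \<Longrightarrow> ext_density S m u \<le> 1"
  using ext_avg_mono[of m u "\<lambda>y. of_bool (y @ u \<in> S)" "\<lambda>_. 1"]
  by (simp add: ext_density_def ext_avg_const)

lemma mean_density_nonneg: "0 \<le> mean_density S n u"
  by (simp add: mean_density_def sum_nonneg ext_density_nonneg)

lemma mean_density_le_1: "\<lbrakk>reduced u; u \<noteq> []\<rbrakk> \<Longrightarrow> mean_density S n u \<le> 1"
  using sum_bounded_above[of "{..<n}" "\<lambda>m. ext_density S m u" 1]
  by (simp add: mean_density_def ext_density_le_1 divide_le_eq)

lemma ext_density_Suc:
  assumes "reduced u" "u \<noteq> []"
  shows "ext_density S (Suc m) u = ext_avg 1 u (\<lambda>x. ext_density S m (x @ u))"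
  using ext_avg_add[OF assms, of m 1] by (simp add: ext_density_def)

text \<open>Shifting the window of the Cesaro mean by one telescopes to a difference of two numbers
  in [0, 1]. Harmonicity therefore holds up to \<open>1 / real n\<close>, and exactly in the
  limit.\<close>

lemma mean_density_ext_avg:
  assumes "reduced u" "u \<noteq> []"
  shows "\<bar>ext_avg 1 u (\<lambda>x. mean_density S n (x @ u)) - mean_density S n u\<bar> \<le> 1 / real n"
proof -
  have "ext_avg 1 u (\<lambda>x. mean_density S n (x @ u)) = (\<Sum>m<n. ext_density S (Suc m) u) / real n"
    using assms by (simp add: mean_density_def ext_avg_divide ext_avg_sum ext_density_Suc)
  moreover have "(\<Sum>m<n. ext_density S (Suc m) u) - (\<Sum>m<n. ext_density S m u)
      = ext_density S n u - ext_density S 0 u"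
    using sum_lessThan_telescope[of "\<lambda>m. ext_density S m u" n] by (simp add: sum_subtractf)
  ultimately have "ext_avg 1 u (\<lambda>x. mean_density S n (x @ u)) - mean_density S n u
      = (ext_density S n u - ext_density S 0 u) / real n"
    by (simp add: mean_density_def diff_divide_distrib[symmetric])
  moreover have "\<bar>ext_density S n u - ext_density S 0 u\<bar> \<le> 1"
    using assms ext_density_nonneg[of S n u] ext_density_nonneg[of S 0 u]
      ext_density_le_1[of u S n] ext_density_le_1[of u S 0] by auto
  ultimately show ?thesis by (simp add: divide_right_mono)
qed

lemma ext_avg_tendsto:
  assumes "\<And>x. x \<in> left_ext l u \<Longrightarrow> ((\<lambda>j. f j x) \<longlongrightarrow> g x) F"
  shows "((\<lambda>j. ext_avg l u (f j)) \<longlongrightarrow> ext_avg l u g) F"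
  unfolding ext_avg_def divide_inverse
  by (intro tendsto_mult tendsto_sum tendsto_const assms)

text \<open>One subsequence \<open>N\<close> serves all words at once, so that relations between
  densities of different words pass to \<open>g\<close>. It exists because there are only countably
  many words and the means are bounded.\<close>

locale limit_density =
  fixes S :: "'a::finite fg_word set" and N :: "nat \<Rightarrow> nat" and g :: "'a fg_word \<Rightarrow> real"
  assumes N: "strict_mono N"
    and tendsto_g: "\<lbrakk>reduced u; u \<noteq> []\<rbrakk> \<Longrightarrow> (\<lambda>j. mean_density S (N j) u) \<longlonglongrightarrow> g u"
begin

lemma inverse_N: "(\<lambda>j. c / real (N j)) \<longlonglongrightarrow> 0"
  using LIMSEQ_subseq_LIMSEQ[OF lim_const_over_n[of c] N] by (simp add: o_def)

lemma N_pos: "eventually (\<lambda>j. N j > 0) sequentially"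
  using eventually_gt_at_top[of 0] by eventually_elim (metis N seq_suble less_le_trans)

lemma g_nonneg: "\<lbrakk>reduced u; u \<noteq> []\<rbrakk> \<Longrightarrow> 0 \<le> g u"
  by (rule LIMSEQ_le_const[OF tendsto_g]) (auto simp: mean_density_nonneg)

lemma g_le_1: "\<lbrakk>reduced u; u \<noteq> []\<rbrakk> \<Longrightarrow> g u \<le> 1"
  by (rule LIMSEQ_le_const2[OF tendsto_g]) (auto simp: mean_density_le_1)

lemma harmonic_1:
  assumes "reduced u" "u \<noteq> []"
  shows "ext_avg 1 u (\<lambda>x. g (x @ u)) = g u"
proof (rule LIMSEQ_unique)
  show "(\<lambda>j. ext_avg 1 u (\<lambda>x. mean_density S (N j) (x @ u))) \<longlonglongrightarrow> ext_avg 1 u (\<lambda>x. g (x @ u))"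
    by (intro ext_avg_tendsto tendsto_g) (use assms in \<open>auto simp: left_ext_def\<close>)
  have "(\<lambda>j. ext_avg 1 u (\<lambda>x. mean_density S (N j) (x @ u)) - mean_density S (N j) u) \<longlonglongrightarrow> 0"
    by (rule Lim_null_comparison[OF _ inverse_N[of 1]])
      (use mean_density_ext_avg[OF assms] in \<open>auto simp: real_norm_def\<close>)
  from tendsto_add[OF this tendsto_g[OF assms]]
  show "(\<lambda>j. ext_avg 1 u (\<lambda>x. mean_density S (N j) (x @ u))) \<longlonglongrightarrow> g u" by simp
qed

lemma harmonic:
  assumes "reduced u" "u \<noteq> []"
  shows "ext_avg l u (\<lambda>x. g (x @ u)) = g u"
proof (induction l)
  case 0
  then show ?case using assms by (simp add: ext_avg_def left_ext_0)
next
  case (Suc l)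
  have "ext_avg (1 + l) u (\<lambda>x. g (x @ u))
      = ext_avg l u (\<lambda>y. ext_avg 1 (y @ u) (\<lambda>x. g (x @ y @ u)))"
    using ext_avg_add[OF assms, of 1 l "\<lambda>x. g (x @ u)"] by simp
  also have "\<dots> = ext_avg l u (\<lambda>y. g (y @ u))"
    using assms by (intro ext_avg_cong harmonic_1) (auto simp: left_ext_def)
  finally show ?case using Suc by simp
qed

text \<open>A Cesaro limit forgets finitely many terms: those below \<open>M\<close> add at most
  \<open>real M / real n\<close> to the mean.\<close>

lemma g_le_if_ext_density_le:
  assumes u: "reduced u" "u \<noteq> []" and le: "\<And>m. m \<ge> M \<Longrightarrow> ext_density S m u \<le> c"
  shows "g u \<le> c"
proof (rule LIMSEQ_le[OF tendsto_g[OF u]])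
  have "0 \<le> c"
    using le[of M] ext_density_nonneg[of S M u] by simp
  have "(\<Sum>m<n. ext_density S m u) \<le> real M + c * real n" for n
  proof -
    have "(\<Sum>m<n. ext_density S m u) \<le> (\<Sum>m<n. of_bool (m < M) + c)"
      using ext_density_le_1[OF u] le \<open>0 \<le> c\<close>
      by (intro sum_mono) (auto simp: add_increasing2 not_less)
    also have "\<dots> = real (card {m. m < n \<and> m < M}) + c * real n"
      by (simp add: sum.distrib Int_def)
    also have "card {m. m < n \<and> m < M} \<le> card {..<M}"
      by (intro card_mono) auto
    finally show ?thesis by simp
  qed
  then have "mean_density S n u \<le> real M / real n + c" if "n > 0" for n
    using that by (simp add: mean_density_def field_simps)
  then show "\<exists>K. \<forall>j\<ge>K. mean_density S (N j) u \<le> real M / real (N j) + c"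
    using N_pos unfolding eventually_sequentially by blast
  show "(\<lambda>j. real M / real (N j) + c) \<longlonglongrightarrow> c"
    using tendsto_add[OF inverse_N[of "real M"] tendsto_const[of c]] by simp
qed

lemma sum_g_le_1:
  assumes "\<And>i. i < n \<Longrightarrow> reduced (h i) \<and> h i \<noteq> []"
    and le: "\<And>m. (\<Sum>i<n. ext_density S m (h i)) \<le> 1"
  shows "(\<Sum>i<n. g (h i)) \<le> 1"
proof (rule LIMSEQ_le_const2)
  show "(\<lambda>j. \<Sum>i<n. mean_density S (N j) (h i)) \<longlonglongrightarrow> (\<Sum>i<n. g (h i))"
    using assms by (intro tendsto_sum tendsto_g) auto
  have "(\<Sum>i<n. mean_density S M (h i)) \<le> 1" for M
  proof -
    have "(\<Sum>i<n. mean_density S M (h i)) = (\<Sum>m<M. \<Sum>i<n. ext_density S m (h i)) / real M"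
      by (simp add: mean_density_def sum_divide_distrib[symmetric] sum.swap[of _ "{..<n}"])
    also have "\<dots> \<le> 1"
      using sum_bounded_above[of "{..<M}" "\<lambda>m. \<Sum>i<n. ext_density S m (h i)" 1] le
      by (simp add: divide_le_eq)
    finally show ?thesis .
  qed
  then show "\<exists>K. \<forall>j\<ge>K. (\<Sum>i<n. mean_density S (N j) (h i)) \<le> 1" by blast
qed

text \<open>By harmonicity \<open>g u\<close> is the average of \<open>g\<close> over the
  extensions. This allows a suffix to be lengthened without lowering \<open>g\<close>.\<close>

lemma exists_ext_ge:
  assumes "reduced u" "u \<noteq> []"
  shows "\<exists>x\<in>left_ext l u. g u \<le> g (x @ u)"
proof (rule ccontr)
  assume "\<not> ?thesis"
  then have less: "g (x @ u) < g u" if "x \<in> left_ext l u" for x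
    using that by force
  have pos: "0 < real (card (left_ext l u))"
    using card_left_ext_pos[OF assms] .
  then have "left_ext l u \<noteq> {}" by auto
  then have "(\<Sum>x\<in>left_ext l u. g (x @ u)) < (\<Sum>x\<in>left_ext l u. g u)"
    using less by (intro sum_strict_mono) auto
  then have "ext_avg l u (\<lambda>x. g (x @ u)) < ext_avg l u (\<lambda>x. g u)"
    unfolding ext_avg_def using pos by (rule divide_strict_right_mono)
  then show False
    using assms by (simp add: harmonic ext_avg_const)
qed

section \<open>Second moments and L2-convergence of the martingale\<close>

definition energy :: "nat \<Rightarrow> 'a fg_word \<Rightarrow> real" where
  "energy m u = ext_avg m u (\<lambda>y. (g (y @ u))\<^sup>2)"

text \<open>By harmonicity \<open>g (y @ u)\<close> is the mean of \<open>g (x @ y @ u)\<close> over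
  \<open>x\<close>, so the inner average is a conditional variance: mean square minus squared
  mean.\<close>

lemma avg_sq_increment:
  assumes "reduced u" "u \<noteq> []"
  shows "ext_avg m u (\<lambda>y. ext_avg l (y @ u) (\<lambda>x. (g (x @ y @ u) - g (y @ u))\<^sup>2))
    = energy (l + m) u - energy m u"
proof -
  have *: "ext_avg l w (\<lambda>x. (g (x @ w) - g w)\<^sup>2) = ext_avg l w (\<lambda>x. (g (x @ w))\<^sup>2) - (g w)\<^sup>2"
    if "reduced w" "w \<noteq> []" for w
  proof -
    have "(\<lambda>x. (g (x @ w) - g w)\<^sup>2) = (\<lambda>x. ((g (x @ w))\<^sup>2 - 2 * g w * g (x @ w)) + (g w)\<^sup>2)"
      by (simp add: power2_diff algebra_simps)
    then have "ext_avg l w (\<lambda>x. (g (x @ w) - g w)\<^sup>2)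
        = ext_avg l w (\<lambda>x. (g (x @ w))\<^sup>2) - 2 * g w * g w + (g w)\<^sup>2"
      by (simp only: ext_avg_plus ext_avg_diff ext_avg_cmult ext_avg_const[OF that] harmonic[OF that])
    then show ?thesis by (simp add: power2_eq_square)
  qed
  have "ext_avg m u (\<lambda>y. ext_avg l (y @ u) (\<lambda>x. (g (x @ y @ u) - g (y @ u))\<^sup>2))
      = ext_avg m u (\<lambda>y. ext_avg l (y @ u) (\<lambda>x. (g (x @ y @ u))\<^sup>2) - (g (y @ u))\<^sup>2)"
    using assms by (intro ext_avg_cong *) (auto simp: left_ext_def)
  also have "\<dots> = energy (l + m) u - energy m u"
    unfolding energy_def ext_avg_diff ext_avg_add[OF assms] by simp
  finally show ?thesis .
qed

lemma convergent_energy: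
  assumes "reduced u" "u \<noteq> []"
  shows "convergent (\<lambda>m. energy m u)"
proof (rule Bseq_monoseq_convergent)
  have "energy m u \<le> energy (Suc m) u" for m
  proof -
    have "0 \<le> energy (1 + m) u - energy m u"
      unfolding avg_sq_increment[OF assms, symmetric] by (intro ext_avg_nonneg) auto
    then show ?thesis by simp
  qed
  then show "monoseq (\<lambda>m. energy m u)" by (simp add: monoseq_Suc)
  have "energy m u \<le> ext_avg m u (\<lambda>_. 1)" for m
    unfolding energy_def
    using assms g_nonneg g_le_1 by (intro ext_avg_mono) (auto simp: left_ext_def abs_square_le_1)
  moreover have "0 \<le> energy m u" for m
    unfolding energy_def by (intro ext_avg_nonneg) auto
  ultimately show "Bseq (\<lambda>m. energy m u)"
    using assms by (intro BseqI'[where K = 1]) (simp add: ext_avg_const)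
qed

text \<open>The worst extension counts, not the average one, since the bound is applied to specific
  extensions: those leading to a given factor and to its product with \<open>h\<close>.\<close>

definition oscillates :: "real \<Rightarrow> nat \<Rightarrow> 'a fg_word \<Rightarrow> bool" where
  "oscillates d l w \<longleftrightarrow> (\<exists>x\<in>left_ext l w. d \<le> \<bar>g (x @ w) - g w\<bar>)"

text \<open>L2-convergence of the martingale \<^term>\<open>g\<close>, combined with Chebyshev's inequality.\<close>

lemma oscillates_tendsto_0:
  assumes u: "reduced u" "u \<noteq> []" and "d > 0"
  shows "(\<lambda>m. ext_avg m u (\<lambda>y. of_bool (oscillates d l (y @ u)))) \<longlonglongrightarrow> 0"
proof -
  \<comment> \<open>Chebyshev contributes \<open>1 / d\<^sup>2\<close>; the number of extensions
    turns the average into a sum, which dominates its largest term.\<close>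
  define C where "C = real (branching TYPE('a) ^ l) / d\<^sup>2"
  have le: "of_bool (oscillates d l w) \<le> C * ext_avg l w (\<lambda>x. (g (x @ w) - g w)\<^sup>2)"
    if "reduced w" "w \<noteq> []" for w
  proof (cases "oscillates d l w")
    case True
    then obtain x where x: "x \<in> left_ext l w" "d \<le> \<bar>g (x @ w) - g w\<bar>"
      by (auto simp: oscillates_def)
    have "d\<^sup>2 \<le> (g (x @ w) - g w)\<^sup>2"
      using x \<open>d > 0\<close> by (simp add: abs_le_square_iff[symmetric])
    also have "\<dots> \<le> (\<Sum>x\<in>left_ext l w. (g (x @ w) - g w)\<^sup>2)"
      using x by (intro member_le_sum) auto
    finally have "1 \<le> (\<Sum>x\<in>left_ext l w. (g (x @ w) - g w)\<^sup>2) / d\<^sup>2"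
      using \<open>d > 0\<close> by simp
    also have "\<dots> = C * ext_avg l w (\<lambda>x. (g (x @ w) - g w)\<^sup>2)"
      using card_left_ext_pos[OF that, of l]
      unfolding C_def ext_avg_def card_left_ext[OF that, of l, symmetric] by auto
    finally show ?thesis using True by simp
  next
    case False
    have "0 \<le> C"
      unfolding C_def by (intro divide_nonneg_nonneg of_nat_0_le_iff zero_le_power2)
    then have "0 \<le> C * ext_avg l w (\<lambda>x. (g (x @ w) - g w)\<^sup>2)"
      by (intro mult_nonneg_nonneg ext_avg_nonneg zero_le_power2)
    then show ?thesis using False by simp
  qed
  have bound: "ext_avg m u (\<lambda>y. of_bool (oscillates d l (y @ u)))
      \<le> C * (energy (l + m) u - energy m u)" for m
  proof -
    have "ext_avg m u (\<lambda>y. of_bool (oscillates d l (y @ u)))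
        \<le> ext_avg m u (\<lambda>y. C * ext_avg l (y @ u) (\<lambda>x. (g (x @ y @ u) - g (y @ u))\<^sup>2))"
    proof (rule ext_avg_mono)
      fix y assume "y \<in> left_ext m u"
      then have "reduced (y @ u)" "y @ u \<noteq> []" using u by (auto simp: left_ext_def)
      from le[OF this] show "of_bool (oscillates d l (y @ u))
          \<le> C * ext_avg l (y @ u) (\<lambda>x. (g (x @ y @ u) - g (y @ u))\<^sup>2)" .
    qed
    also have "\<dots> = C * (energy (l + m) u - energy m u)"
      unfolding avg_sq_increment[OF u, symmetric] by (rule ext_avg_cmult)
    finally show ?thesis .
  qed
  obtain L where L: "(\<lambda>m. energy m u) \<longlonglongrightarrow> L"
    using convergent_energy[OF u] by (auto simp: convergent_def)
  have "(\<lambda>m. C * (energy (l + m) u - energy m u)) \<longlonglongrightarrow> C * (L - L)"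
    using LIMSEQ_ignore_initial_segment[OF L, of l]
    by (intro tendsto_intros L) (simp add: add.commute)
  then have lim: "(\<lambda>m. C * (energy (l + m) u - energy m u)) \<longlonglongrightarrow> 0" by simp
  have "0 \<le> ext_avg m u (\<lambda>y. of_bool (oscillates d l (y @ u)))" for m
    by (intro ext_avg_nonneg) simp
  then show ?thesis
    by (intro tendsto_sandwich[OF _ _ tendsto_const lim] always_eventually allI bound)
qed

end

section \<open>Bounding the proportion of complete cancellations\<close>

lemma reduced_cyclic_const:
  fixes w :: "'a::finite fg_word"
  assumes "CARD('a) = 1" "reduced w" "a \<in> set w" "b \<in> set w"
  shows "a = b"
proof -
  obtain x :: 'a where x: "(UNIV :: 'a set) = {x}"
    using assms(1) card_1_singletonE by blast
  have eq: "d = c" if "d \<noteq> inv_letter c" for c d :: "'a \<times> bool"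
  proof -
    have "fst c = x" "fst d = x" using x by auto
    then show ?thesis using that by (cases c; cases d) (auto simp: inv_letter_def)
  qed
  have "set w \<subseteq> {hd w}"
    using assms(2) by (induction w) (auto simp: reduced_Cons dest!: eq)
  then show ?thesis using assms by auto
qed

text \<open>The bound depends on \<open>u\<close> only, as \<open>h\<close> changes along the
  iteration. With two or more generators the proportion decays at least like
  \<open>2 ^ length h\<close>. With one generator there is no decay, but a reduced word is a power
  of a single letter, so \<open>y @ u\<close> cannot contain the inverse of the last letter of
  \<open>u\<close>.\<close>

lemma ext_avg_start_inverse_le:
  fixes u :: "'a::finite fg_word"
  assumes u: "reduced u" "u \<noteq> []" and "c \<le> 2 ^ length u" "0 < c"
    and h: "h = z @ u" and m: "length h \<le> m"
  shows "ext_avg m u (\<lambda>y. of_bool (take (length h) y = inv_word h)) \<le> 1 / c"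
proof (cases "CARD('a) = 1")
  case True
  have "take (length h) y \<noteq> inv_word h" if "y \<in> left_ext m u" for y
  proof
    assume eq: "take (length h) y = inv_word h"
    have "last h \<in> set h" "last h = last u" using u h by auto
    then have "inv_letter (last u) \<in> set (take (length h) y)"
      unfolding eq by (auto simp: inv_word_def)
    then have "inv_letter (last u) \<in> set (y @ u)"
      by (auto dest: in_set_takeD)
    then have "inv_letter (last u) = last u"
      using that u by (intro reduced_cyclic_const[OF True, of "y @ u"]) (auto simp: left_ext_def)
    then show False by (simp add: inv_letter_def prod_eq_iff)
  qed
  then have "ext_avg m u (\<lambda>y. of_bool (take (length h) y = inv_word h)) = ext_avg m u (\<lambda>y. 0)"
    by (intro ext_avg_cong) auto
  then show ?thesis using u \<open>0 < c\<close> by (simp add: ext_avg_const)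
next
  case False
  then have q: "2 \<le> branching TYPE('a)"
    using zero_less_card_finite[where 'a='a] by linarith
  have "c \<le> 2 ^ length u" by fact
  also have "\<dots> \<le> (2::real) ^ length h" using h by (intro power_increasing) auto
  also have "\<dots> \<le> real (branching TYPE('a)) ^ length h"
    using q by (intro power_mono) linarith+
  finally have "1 / real (branching TYPE('a)) ^ length h \<le> 1 / c"
    using \<open>0 < c\<close> by (intro divide_left_mono) auto
  then show ?thesis
    using ext_avg_take[OF u m, of "inv_word h"] by linarith
qed

section \<open>One step of the iteration, and the bound on limit densities\<close>

context limit_density
begin

text \<open>If no such \<open>s\<close> exists, every \<open>y @ u\<close> in \<open>S\<close> with
  \<open>y\<close> long is bad in one of three ways: \<open>g (y @ u) \<le> \<sigma> - d\<close>, of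
  proportion at most \<open>(\<sigma> - g u) / d\<close> by Markov; \<open>h\<close> cancelled
  completely, at most \<open>1 / c\<close>; or an oscillation, of proportion tending to 0. By
  \<open>slack\<close> this is too little for the density \<open>g u\<close>.\<close>

lemma exists_S_step:
  assumes u: "reduced u" "u \<noteq> []"
    and sup: "\<And>w. \<lbrakk>reduced w; w \<noteq> []\<rbrakk> \<Longrightarrow> g w \<le> \<sigma>" and "d > 0"
    and c: "0 < c" "c \<le> 2 ^ length u" and slack: "(\<sigma> - g u) / d + 1 / c < g u"
    and h: "h = z @ u" "reduced h"
  shows "\<exists>s\<in>S. \<exists>y'. reduced (y' @ u) \<and> hd (y' @ u) = hd h \<and> \<sigma> - 3 * d < g (y' @ u) \<and>
    (\<forall>x. reduced (x @ h) \<longrightarrow> reduce (x @ h @ s) = x @ y' @ u)"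
proof (rule ccontr)
  assume none: "\<not> ?thesis"
  define H where "H = length h"
  \<comment> \<open>Union bound over the number \<open>i\<close> of cancelled letters, which depends
    on \<open>y\<close>. From the word left after the cancellation, \<open>i\<close> letters lead
    back to \<open>y @ u\<close> and \<open>H - i\<close> letters lead to the product with
    \<open>h\<close>.\<close>
  define osc where
    "osc m = (\<Sum>i<H. ext_avg (m - i) u (\<lambda>y. of_bool (oscillates d i (y @ u)))
                 + ext_avg (m - i) u (\<lambda>y. of_bool (oscillates d (H - i) (y @ u))))" for m
  have osc_lim: "osc \<longlonglongrightarrow> 0"
  proof -
    have "(\<lambda>m. ext_avg (m - i) u (\<lambda>y. of_bool (oscillates d l (y @ u)))) \<longlonglongrightarrow> 0" for i l
      by (rule filterlim_compose[OF oscillates_tendsto_0[OF u \<open>d > 0\<close>] filterlim_minus_const_nat_at_top])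
    then have "osc \<longlonglongrightarrow> (\<Sum>i<H. 0 + 0)"
      unfolding osc_def by (intro tendsto_sum tendsto_add)
    then show ?thesis by simp
  qed
  have bad: "g (y @ u) \<le> \<sigma> - d \<or> take H y = inv_word h
      \<or> (\<exists>i<H. oscillates d i (drop i y @ u) \<or> oscillates d (H - i) (drop i y @ u))"
    if y: "y \<in> left_ext m u" "y @ u \<in> S" and m: "H \<le> m" for y m
  proof (rule ccontr)
    assume good: "\<not> ?thesis"
    have ly: "length y = m" and ry: "reduced (y @ u)" using y by (auto simp: left_ext_def)
    obtain h' e v' where hv: "h = h' @ e" "y @ u = inv_word e @ v'" "h' \<noteq> []" "reduced (h' @ v')"
      using cancellation_split[of h "y @ u"] h u ry good m ly unfolding H_def by auto
    define i where "i = length e"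
    have i: "i < H" "H - i = length h'" using hv by (auto simp: i_def H_def)
    have v': "v' = drop i y @ u"
    proof -
      have "v' = drop i (y @ u)" unfolding hv(2) by (simp add: i_def)
      then show ?thesis using i m ly by simp
    qed
    have "inv_word e \<in> left_ext i v'" "h' \<in> left_ext (H - i) v'"
      using hv ry i by (auto simp: left_ext_def i_def)
    moreover have "\<not> oscillates d i v'" "\<not> oscillates d (H - i) v'"
      using good i unfolding v' by blast+
    \<comment> \<open>\<open>v'\<close> is a common suffix of \<open>y @ u\<close> and the product
      \<open>h' @ v'\<close>. Going from one to the other through \<open>v'\<close> costs less than
      \<open>2 * d\<close>, after the first loss of \<open>d\<close> below
      \<open>\<sigma>\<close>.\<close>
    ultimately have "\<bar>g (inv_word e @ v') - g v'\<bar> < d" "\<bar>g (h' @ v') - g v'\<bar> < d"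
      unfolding oscillates_def by force+
    moreover have "\<sigma> - d < g (inv_word e @ v')"
      using good hv by auto
    ultimately have large: "\<sigma> - 3 * d < g (h' @ v')" by linarith
    have "hd (h' @ v') = hd h" using hv(3) unfolding hv(1) by simp
    moreover have "reduce (x @ h @ y @ u) = x @ h' @ v'" if "reduced (x @ h)" for x
    proof -
      have "reduce (x @ h @ y @ u) = reduce ((x @ h') @ e @ inv_word e @ v')"
        unfolding hv by simp
      also have "\<dots> = reduce (x @ h' @ v')"
        unfolding reduce_cancel by simp
      also have "\<dots> = x @ h' @ v'"
        using that hv by (intro reduce_reduced) (simp add: reduced_append)
      finally show ?thesis .
    qed
    ultimately have "reduced ((h' @ drop i y) @ u) \<and> hd ((h' @ drop i y) @ u) = hd h
        \<and> \<sigma> - 3 * d < g ((h' @ drop i y) @ u)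
        \<and> (\<forall>x. reduced (x @ h) \<longrightarrow> reduce (x @ h @ y @ u) = x @ (h' @ drop i y) @ u)"
      using hv(4) large unfolding v' by simp
    then show False using none y(2) by blast
  qed
  have le: "ext_density S m u \<le> (\<sigma> - g u) / d + 1 / c + osc m" if m: "H \<le> m" for m
  proof -
    \<comment> \<open>Markov majorant: nonnegative by \<open>sup\<close>, at least 1 when
      \<open>g (y @ u) \<le> \<sigma> - d\<close>, and with an average that harmonicity evaluates
      exactly.\<close>
    let ?A = "\<lambda>y. (\<sigma> - g (y @ u)) / d"
    let ?B = "\<lambda>y. of_bool (take H y = inv_word h) :: real"
    let ?O = "\<lambda>l w. of_bool (oscillates d l (w @ u)) :: real"
    have "ext_density S m u
        \<le> ext_avg m u (\<lambda>y. ?A y + ?B y + (\<Sum>i<H. ?O i (drop i y) + ?O (H - i) (drop i y)))"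
      unfolding ext_density_def
    proof (rule ext_avg_mono)
      fix y assume y: "y \<in> left_ext m u"
      then have "g (y @ u) \<le> \<sigma>" using u by (intro sup) (auto simp: left_ext_def)
      then have A: "0 \<le> ?A y" using \<open>d > 0\<close> by simp
      have O: "0 \<le> (\<Sum>i<H. ?O i (drop i y) + ?O (H - i) (drop i y))"
        by (intro sum_nonneg) auto
      show "of_bool (y @ u \<in> S) \<le> ?A y + ?B y + (\<Sum>i<H. ?O i (drop i y) + ?O (H - i) (drop i y))"
      proof (cases "y @ u \<in> S")
        case True
        then consider "g (y @ u) \<le> \<sigma> - d" | "take H y = inv_word h"
          | i where "i < H" "oscillates d i (drop i y @ u) \<or> oscillates d (H - i) (drop i y @ u)"
          using bad[OF y _ m] by blast
        then show ?thesis
        proof cases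
          case 1
          then have "1 \<le> ?A y" using \<open>d > 0\<close> by simp
          then show ?thesis using O by (simp add: add_increasing2)
        next
          case 2
          then show ?thesis using A O by simp
        next
          case 3
          have "?O i (drop i y) + ?O (H - i) (drop i y)
              \<le> (\<Sum>i<H. ?O i (drop i y) + ?O (H - i) (drop i y))"
            using 3 by (intro member_le_sum) auto
          moreover have "1 \<le> ?O i (drop i y) + ?O (H - i) (drop i y)"
            using 3 by auto
          ultimately show ?thesis using A by (simp add: add_increasing)
        qed
      next
        case False
        then show ?thesis using A O by simp
      qed
    qed
    also have "\<dots> = ext_avg m u ?A + ext_avg m u ?B
        + (\<Sum>i<H. ext_avg m u (\<lambda>y. ?O i (drop i y)) + ext_avg m u (\<lambda>y. ?O (H - i) (drop i y)))"
      by (simp only: ext_avg_plus ext_avg_sum)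
    also have "ext_avg m u ?A = (\<sigma> - g u) / d"
      by (simp only: ext_avg_divide ext_avg_diff ext_avg_const[OF u] harmonic[OF u])
    also have "(\<Sum>i<H. ext_avg m u (\<lambda>y. ?O i (drop i y)) + ext_avg m u (\<lambda>y. ?O (H - i) (drop i y)))
        = osc m"
    proof -
      have "ext_avg m u (\<lambda>y. ?O l (drop i y)) = ext_avg (m - i) u (?O l)" if "i < H" for i l
        using ext_avg_drop[OF u, of i m "?O l"] that m by simp
      then show ?thesis unfolding osc_def by (intro sum.cong) auto
    qed
    also have "ext_avg m u ?B \<le> 1 / c"
      using ext_avg_start_inverse_le[OF u c(2,1) h(1)] m unfolding H_def by simp
    finally show ?thesis by simp
  qed
  \<comment> \<open>The gap in \<open>slack\<close>; half of it absorbs \<open>osc\<close>, the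
    other half gives the contradiction.\<close>
  define r where "r = g u - ((\<sigma> - g u) / d + 1 / c)"
  have "r > 0" using slack by (simp add: r_def)
  then obtain M where M: "\<And>m. m \<ge> M \<Longrightarrow> osc m < r / 2"
    using order_tendstoD(2)[OF osc_lim, of "r / 2"] unfolding eventually_sequentially by auto
  have "g u \<le> g u - r / 2"
  proof (rule g_le_if_ext_density_le[OF u, of "max M H"])
    fix m assume "max M H \<le> m"
    then have "ext_density S m u \<le> g u - r + osc m" "osc m < r / 2"
      using le[of m] M[of m] by (simp_all add: r_def)
    then show "ext_density S m u \<le> g u - r / 2" by simp
  qed
  then show False using \<open>r > 0\<close> by simp
qed

lemma g_le_inverse:
  assumes k: "k \<ge> 2" and S: "S \<subseteq> free_group" and free: "strongly_product_free k S"
    and w: "reduced w" "w \<noteq> []"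
  shows "g w \<le> 1 / real k"
proof (rule ccontr)
  assume large: "\<not> g w \<le> 1 / real k"
  define \<sigma> where "\<sigma> = (SUP w\<in>{w. reduced w \<and> w \<noteq> []}. g w)"
  have bdd: "bdd_above (g ` {w. reduced w \<and> w \<noteq> []})"
    using g_le_1 by (auto intro!: bdd_aboveI[of _ 1])
  have sup: "g w \<le> \<sigma>" if "reduced w" "w \<noteq> []" for w
    unfolding \<sigma>_def using that by (intro cSUP_upper bdd) auto
  \<comment> \<open>The three losses of \<open>d\<close> in \<open>exists_S_step\<close> bring
    \<open>\<sigma>\<close> down to exactly \<open>1 / real k\<close>.\<close>
  define d where "d = (\<sigma> - 1 / real k) / 3"
  have d: "d > 0" "\<sigma> - 3 * d = 1 / real k"
    using sup[OF w] large by (simp add: d_def) (simp add: d_def diff_divide_distrib)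
  \<comment> \<open>Chosen so that the Markov term stays below \<open>1 / real (2 * k)\<close>. With
    \<open>c = 2 * k\<close> the two error terms then sum to less than
    \<open>1 / real k\<close>.\<close>
  define \<eta> where "\<eta> = d / (2 * real k)"
  have "\<eta> > 0" "\<eta> \<le> d" using d k by (auto simp: \<eta>_def divide_le_eq)
  have "\<exists>u0\<in>{w. reduced w \<and> w \<noteq> []}. \<sigma> - \<eta> < g u0"
    using less_cSUP_iff[OF _ bdd, of "\<sigma> - \<eta>"] w \<open>\<eta> > 0\<close> unfolding \<sigma>_def by auto
  then obtain u0 where u0: "reduced u0" "u0 \<noteq> []" "\<sigma> - \<eta> < g u0" by blast
  \<comment> \<open>The \<open>2 * k\<close> additional letters ensure
    \<open>2 * k \<le> 2 ^ length u\<close>.\<close>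
  obtain x where x: "x \<in> left_ext (2 * k) u0" "g u0 \<le> g (x @ u0)"
    using exists_ext_ge[OF u0(1,2)] by blast
  define u where "u = x @ u0"
  have u: "reduced u" "u \<noteq> []" "\<sigma> - \<eta> < g u" "2 * k \<le> length u"
    using x u0 by (auto simp: u_def left_ext_def)
  have "2 * k \<le> 2 ^ (2 * k)" by (rule less_imp_le[OF less_exp])
  also have "\<dots> \<le> 2 ^ length u" using u by (intro power_increasing) auto
  finally have "real (2 * k) \<le> real (2 ^ length u)" by (rule of_nat_mono)
  then have c: "0 < real (2 * k)" "real (2 * k) \<le> 2 ^ length u" using k by auto
  have gu: "1 / real k < g u" unfolding d(2)[symmetric] using u(3) d(1) \<open>\<eta> \<le> d\<close> by linarith
  have "(\<sigma> - g u) / d < \<eta> / d" using u d by (intro divide_strict_right_mono) auto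
  also have "\<dots> = 1 / real (2 * k)" using d by (simp add: \<eta>_def)
  finally have slack: "(\<sigma> - g u) / d + 1 / real (2 * k) < g u"
    using gu by (simp add: field_simps)

  \<comment> \<open>The suffix \<open>u\<close> allows the step to be repeated, and the fixed first
    letter gives all words of the chain the same admissible prefixes. \<open>?R\<close> is required
    for every such prefix \<open>x\<close>, because one chain of factors must serve all of
    them.\<close>
  let ?P = "\<lambda>h. reduced h \<and> (\<exists>z. h = z @ u) \<and> hd h = hd u \<and> 1 / real k < g h"
  let ?R = "\<lambda>h h'. \<exists>s\<in>S. \<forall>x. reduced (x @ h) \<longrightarrow> reduce (x @ h @ s) = x @ h'"
  have "\<exists>hs. \<forall>n. ?P (hs n) \<and> ?R (hs n) (hs (Suc n))"
  proof (rule dependent_nat_choice)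
    show "\<exists>h. ?P h" using u gu by auto
    fix h :: "'a fg_word" and n :: nat assume "?P h"
    then obtain z where h: "h = z @ u" "reduced h" "hd h = hd u" by blast
    have "\<exists>s\<in>S. \<exists>y'. reduced (y' @ u) \<and> hd (y' @ u) = hd h \<and> \<sigma> - 3 * d < g (y' @ u) \<and>
        (\<forall>x. reduced (x @ h) \<longrightarrow> reduce (x @ h @ s) = x @ y' @ u)"
      by (rule exists_S_step[OF u(1,2) _ d(1) c slack h(1,2)]) (rule sup)
    then show "\<exists>h'. ?P h' \<and> ?R h h'"
      unfolding d(2) h(3) by blast
  qed
  then obtain hs where hs: "\<And>n. ?P (hs n)" "\<And>n. ?R (hs n) (hs (Suc n))" by blast
  then obtain ss where ss: "\<And>n. ss n \<in> S"
    "\<And>n x. reduced (x @ hs n) \<Longrightarrow> reduce (x @ hs n @ ss n) = x @ hs (Suc n)"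
    by metis
  have ne: "hs n \<noteq> []" for n using hs(1)[of n] u(2) by auto
  have red: "reduced (x @ hs n) \<longleftrightarrow> reduced (x @ u)" for x n
    using hs(1)[of n] ne[of n] u by (auto simp: reduced_append)
  have chain: "reduce (x @ hs i @ concat (map ss [i..<j])) = x @ hs j"
    if "reduced (x @ u)" "i \<le> j" for x i j
    using that(2)
  proof (induction rule: dec_induct)
    case base
    then show ?case using that(1) red by (simp add: reduce_reduced)
  next
    case (step j)
    have "reduce (x @ hs i @ concat (map ss [i..<Suc j]))
        = reduce (reduce (x @ hs i @ concat (map ss [i..<j])) @ ss j)"
      using step.hyps by (simp add: reduce_reduce_append)
    also have "\<dots> = x @ hs (Suc j)"
      using step.IH ss(2)[of x j] that(1) red by simp
    finally show ?case .
  qed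
  have disjoint: False
    if "reduced (x @ u)" "i < j" "j < k" "x @ hs i \<in> S" "x @ hs j \<in> S" for x i j
  proof -
    \<comment> \<open>There are \<open>j - i\<close> factors \<open>ss\<close> and one leading
      factor. As \<open>i < j < k\<close>, their number lies between 2 and \<open>k\<close>.\<close>
    let ?ws = "(x @ hs i) # map ss [i..<j]"
    have "fg_prod ?ws = x @ hs j"
      using chain[of x i j] that by (simp add: fg_prod_eq_reduce_concat)
    moreover have "length ?ws = Suc (j - i)" "set ?ws \<subseteq> S"
      using that ss by auto
    ultimately have "\<not> l_product_free (Suc (j - i)) S"
      using that unfolding l_product_free_def by blast
    moreover have "2 \<le> Suc (j - i)" "Suc (j - i) \<le> k" using that by auto
    ultimately show False using free unfolding strongly_product_free_def by blast
  qed
  have "(\<Sum>i<k. ext_density S m (hs i)) \<le> 1" for m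
  proof -
    have "left_ext m (hs i) = left_ext m u" for i
      using red by (simp add: left_ext_def)
    then have "(\<Sum>i<k. ext_density S m (hs i))
        = ext_avg m u (\<lambda>y. \<Sum>i<k. of_bool (y @ hs i \<in> S))"
      unfolding ext_density_def ext_avg_sum by (simp add: ext_avg_def)
    also have "\<dots> \<le> ext_avg m u (\<lambda>y. 1)"
    proof (rule ext_avg_mono)
      fix y assume "y \<in> left_ext m u"
      then have "reduced (y @ u)" by (simp add: left_ext_def)
      then have "card {i. i < k \<and> y @ hs i \<in> S} \<le> Suc 0"
        using disjoint[of y] by (subst card_le_Suc0_iff_eq) (auto, metis linorder_neqE_nat)
      moreover have "(\<Sum>i<k. of_bool (y @ hs i \<in> S)) = real (card {i. i < k \<and> y @ hs i \<in> S})"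
        by (simp add: Int_def)
      ultimately show "(\<Sum>i<k. of_bool (y @ hs i \<in> S)) \<le> (1::real)" by simp
    qed
    also have "\<dots> = 1" using u by (simp add: ext_avg_const)
    finally show ?thesis .
  qed
  then have "(\<Sum>i<k. g (hs i)) \<le> 1"
    using hs(1) ne by (intro sum_g_le_1) auto
  moreover have "(\<Sum>i<k. 1 / real k) < (\<Sum>i<k. g (hs i))"
    using hs(1) k by (intro sum_strict_mono) (auto simp: lessThan_empty_iff)
  ultimately show False using k by simp
qed

end

subsection \<open>Upper density as a limit density\<close>

lemma finite_level [simp]: "finite (level (A :: 'a::finite fg_word set) n)"
  by (rule finite_subset[OF _ finite_lists_length_eq[of UNIV n]]) (auto simp: level_def)

lemma fg_mu_upto_level:
  fixes A :: "'a::finite fg_word set"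
  shows "fg_mu (upto_level A n)
     = (\<Sum>m\<le>n. real (card (level A m)) / real (card (level (free_group :: 'a fg_word set) m)))"
proof -
  have "upto_level A n = (\<Union>m\<in>{..n}. level A m)"
    by (auto simp: upto_level_def level_def)
  then have "fg_mu (upto_level A n) = (\<Sum>m\<le>n. fg_mu (level A m))"
    unfolding fg_mu_def by (simp only:) (rule sum.UNION_disjoint, simp, simp, auto simp: level_def)
  also have "\<dots> = (\<Sum>m\<le>n. real (card (level A m)) / real (card (level (free_group :: 'a fg_word set) m)))"
  proof (intro sum.cong refl)
    fix m
    have "fg_mu (level A m) = (\<Sum>w\<in>level A m. 1 / real (card (level (free_group :: 'a fg_word set) m)))"
      unfolding fg_mu_def by (rule sum.cong) (auto simp: level_def)
    then show "fg_mu (level A m)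
        = real (card (level A m)) / real (card (level (free_group :: 'a fg_word set) m))"
      by simp
  qed
  finally show ?thesis .
qed

text \<open>Words are sorted by their last letter, the one-letter suffix that left extensions
  keep.\<close>

lemma card_level_Suc:
  fixes A :: "'a::finite fg_word set"
  assumes "A \<subseteq> free_group"
  shows "real (card (level A (Suc m)))
       = real (branching TYPE('a) ^ m) * (\<Sum>a\<in>UNIV. ext_density A m [a])"
proof -
  have *: "real (card {x \<in> left_ext m [a]. x @ [a] \<in> A})
      = real (branching TYPE('a) ^ m) * ext_density A m [a]" for a :: "'a \<times> bool"
  proof -
    have card: "card (left_ext m [a]) = branching TYPE('a) ^ m"
      by (rule card_left_ext) auto
    show ?thesis
      using card_left_ext_pos[of "[a]" m]
      unfolding ext_density_def ext_avg_def card[symmetric] by (auto simp: Int_def)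
  qed
  have "bij_betw (\<lambda>(a, x). x @ [a])
      (SIGMA a:UNIV. {x \<in> left_ext m [a]. x @ [a] \<in> A}) (level A (Suc m))"
    using assms by (intro bij_betw_byWitness[where f' = "\<lambda>w. (last w, butlast w)"])
      (auto simp: left_ext_def level_def free_group_def length_Suc_conv_rev)
  then have "card (level A (Suc m)) = card (SIGMA a:(UNIV :: ('a \<times> bool) set).
      {x \<in> left_ext m [a]. x @ [a] \<in> A})"
    by (rule bij_betw_same_card[symmetric])
  also have "\<dots> = (\<Sum>a\<in>UNIV. card {x \<in> left_ext m [a]. x @ [a] \<in> A})"
    by (simp add: card_SigmaI)
  finally show ?thesis
    by (simp only: of_nat_sum * sum_distrib_left)
qed

lemma card_level_free_group_Suc:
  "card (level (free_group :: 'a::finite fg_word set) (Suc m))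
     = 2 * CARD('a) * branching TYPE('a) ^ m"
proof -
  have "ext_density (free_group :: 'a fg_word set) m [a] = 1" for a
  proof -
    have "ext_density (free_group :: 'a fg_word set) m [a] = ext_avg m [a] (\<lambda>y. 1)"
      unfolding ext_density_def by (intro ext_avg_cong) (auto simp: left_ext_def free_group_def)
    then show ?thesis by (simp add: ext_avg_const)
  qed
  then have "real (card (level (free_group :: 'a fg_word set) (Suc m)))
      = real (2 * CARD('a) * branching TYPE('a) ^ m)"
    by (subst card_level_Suc) auto
  then show ?thesis by (simp only: of_nat_eq_iff)
qed

lemma fg_mu_ratio_Suc:
  fixes A :: "'a::finite fg_word set"
  assumes "A \<subseteq> free_group"
  shows "real (card (level A (Suc m))) / real (card (level (free_group :: 'a fg_word set) (Suc m)))
       = (\<Sum>a\<in>UNIV. ext_density A m [a]) / real (2 * CARD('a))"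
  using branching_pos[where 'a='a]
  unfolding card_level_Suc[OF assms] card_level_free_group_Suc by simp

lemma level_free_group_0: "level (free_group :: 'a::finite fg_word set) 0 = {[]}"
  by (auto simp: level_def free_group_def)

lemma fg_mu_upto_level_free_group: "fg_mu (upto_level (free_group :: 'a::finite fg_word set) n) = real (Suc n)"
proof -
  have "card (level (free_group :: 'a fg_word set) m) \<noteq> 0" for m
    using branching_pos[where 'a='a]
    by (cases m) (auto simp: level_free_group_0 card_level_free_group_Suc simp del: card_0_eq)
  then have "fg_mu (upto_level (free_group :: 'a fg_word set) n) = (\<Sum>m\<le>n. 1)"
    unfolding fg_mu_upto_level by (intro sum.cong) (auto simp del: card_0_eq)
  then show ?thesis by simp
qed

text \<open>The empty word ends in no letter and accounts for the term \<open>1 / real n\<close>.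
  Replacing the denominator \<open>Suc n\<close> by \<open>n\<close> only enlarges the
  quotient.\<close>

lemma density_ratio_le:
  fixes A :: "'a::finite fg_word set"
  assumes "A \<subseteq> free_group" "n > 0"
  shows "fg_mu (upto_level A n) / fg_mu (upto_level (free_group :: 'a fg_word set) n)
       \<le> 1 / real n + (\<Sum>a\<in>UNIV. mean_density A n [a]) / real (2 * CARD('a))"
proof -
  let ?r = "\<lambda>m. real (card (level A m)) / real (card (level (free_group :: 'a fg_word set) m))"
  let ?D = "\<Sum>a\<in>UNIV. mean_density A n [a]"
  have "level A 0 \<subseteq> {[]}" by (auto simp: level_def)
  then have "card (level A 0) \<le> 1" by (metis card_mono card.empty card_insert_disjoint
        empty_iff finite.emptyI finite.insertI One_nat_def)
  then have r0: "?r 0 \<le> 1" by (simp add: level_free_group_0)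
  have "fg_mu (upto_level A n) = ?r 0 + (\<Sum>m<n. ?r (Suc m))"
    unfolding fg_mu_upto_level by (rule sum.atMost_shift)
  also have "(\<Sum>m<n. ?r (Suc m)) = (\<Sum>m<n. \<Sum>a\<in>UNIV. ext_density A m [a]) / real (2 * CARD('a))"
    unfolding fg_mu_ratio_Suc[OF assms(1)] by (simp only: sum_divide_distrib)
  also have "(\<Sum>m<n. \<Sum>a\<in>UNIV. ext_density A m [a]) = real n * ?D"
    using \<open>n > 0\<close> by (simp add: mean_density_def sum_divide_distrib[symmetric] sum.swap[of _ UNIV])
  finally have "fg_mu (upto_level A n) \<le> 1 + real n * ?D / real (2 * CARD('a))"
    using r0 by simp
  moreover have "0 \<le> ?D" by (intro sum_nonneg mean_density_nonneg)
  ultimately have "fg_mu (upto_level A n) / real (Suc n)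
      \<le> (1 + real n * ?D / real (2 * CARD('a))) / real n"
    using \<open>n > 0\<close> by (intro frac_le) auto
  also have "\<dots> = 1 / real n + ?D / real (2 * CARD('a))"
    using \<open>n > 0\<close> by (simp add: add_divide_distrib)
  finally show ?thesis by (simp add: fg_mu_upto_level_free_group)
qed

theorem theorem1p2:
  fixes S :: "'a::finite fg_word set" and k :: nat
  assumes "k \<ge> 2"
    and "S \<subseteq> free_group"
    and "strongly_product_free k S"
  shows "upper_density S \<le> ereal (1 / real k)"
proof -
  let ?X = "\<lambda>n. fg_mu (upto_level S n) / fg_mu (upto_level (free_group :: 'a fg_word set) n)"
  obtain r where r: "strict_mono r" "((\<lambda>n. ereal (?X n)) \<circ> r) \<longlonglongrightarrow> upper_density S"
    using limsup_subseq_lim[of "\<lambda>n. ereal (?X n)"] unfolding upper_density_def by blast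
  let ?W = "{w :: 'a fg_word. reduced w \<and> w \<noteq> []}"
  \<comment> \<open>The means lie in [0, 1] on a countable set of words, so a subsequence
    \<open>q\<close> of \<open>r\<close> converges at all of them; along it the limsup is still
    attained.\<close>
  have "countable (lists (UNIV :: ('a \<times> bool) set))"
    by (intro countable_lists countable_finite) simp
  then have "countable ?W" by (rule countable_subset[rotated]) auto
  then obtain q where q: "strict_mono q"
    "\<And>w. w \<in> ?W \<Longrightarrow> \<exists>l. (\<lambda>n. mean_density S (r (q n)) w) \<longlonglongrightarrow> l"
    using function_convergent_subsequence[of ?W "\<lambda>n. mean_density S (r n)" 1]
    by (auto simp: mean_density_nonneg mean_density_le_1)
  define g where "g w = lim (\<lambda>n. mean_density S (r (q n)) w)" for w
  have g: "(\<lambda>n. mean_density S (r (q n)) w) \<longlonglongrightarrow> g w" if "reduced w" "w \<noteq> []" for w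
    using q(2)[of w] that unfolding g_def by (auto simp: limI)
  interpret limit_density S "r \<circ> q" g
    using g strict_mono_o[OF r(1) q(1)] by unfold_locales auto
  let ?Y = "\<lambda>n. 1 / real (r (q n)) + (\<Sum>a\<in>UNIV. mean_density S (r (q n)) [a]) / real (2 * CARD('a))"
  have "(\<lambda>n. ereal (?X (r (q n)))) \<longlonglongrightarrow> upper_density S"
    using LIMSEQ_subseq_LIMSEQ[OF r(2) q(1)] by (simp add: o_def)
  moreover have "(\<lambda>n. ereal (?Y n)) \<longlonglongrightarrow> ereal (0 + (\<Sum>a\<in>UNIV. g [a]) / real (2 * CARD('a)))"
    using inverse_N[of 1] by (intro tendsto_intros g) auto
  moreover have "\<exists>K. \<forall>n\<ge>K. ereal (?X (r (q n))) \<le> ereal (?Y n)"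
    using N_pos density_ratio_le[OF assms(2)] unfolding eventually_sequentially o_def ereal_less_eq
    by blast
  ultimately have "upper_density S \<le> ereal (0 + (\<Sum>a\<in>UNIV. g [a]) / real (2 * CARD('a)))"
    by (rule LIMSEQ_le)
  also have "(\<Sum>a\<in>UNIV. g [a]) \<le> (\<Sum>a\<in>(UNIV :: ('a \<times> bool) set). 1 / real k)"
    using assms by (intro sum_mono g_le_inverse) auto
  then have "ereal (0 + (\<Sum>a\<in>UNIV. g [a]) / real (2 * CARD('a))) \<le> ereal (1 / real k)"
    by (simp add: field_simps)
  finally show ?thesis .
qed

end
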